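(* Let $f:X\to X$ be a continuous map such that $(f,X)$ is conjugate to the inverse limit of an inverse system (over some directed set) of dynamical systems $(f_\lambda,X_\lambda)$, where each $X_\lambda$ is a compact Hausdorff space and each $f_\lambda$ has shadowing. Then $f$ has shadowing.
   Context: $\omega=\{0,1,2,\dots\}$; all maps are continuous. A dynamical system $(f,X)$ is a continuous map $f:X\to X$. Shadowing (topological definition). For a finite open cover $\mathcal U$ of $X$, a sequence $\langle x_i\rangle_{i\in\omega}$ in $X$ is a $\mathcal U$-pseudo-orbit if for every $i\in\omega$ there is $U_{i+1}\in\mathcal U$ with $x_{i+1},f(x_i)\in U_{i+1}$. A point $z\in X$ $\mathcal U$-shadows $\langle x_i\rangle$ if for every $i\in\omega$ there is $U_i\in\mathcal U$ with $x_i,f^i(z)\in U_i$. The map $f$ (on a nonempty space $X$) has shadowing if for every finite open cover $\mathcal U$ there is a finite open cover $\mathcal V$ such that every $\mathcal V$-pseudo-orbit is $\mathcal U$-shadowed by a point of $X$. Inverse limits. Let $(\Lambda,\le)$ be a directed set, $(f_\lambda,X_\lambda)$ a dynamical system on a compact Hausdorff space for each $\lambda\in\Lambda$, and for $\lambda\le\eta$ let $g_\lambda^\eta:X_\eta\to X_\lambda$ be a continuous surjection. This is an inverse system if $g_\lambda^\lambda=\mathrm{id}$, $g_\lambda^\nu=g_\lambda^\eta\circ g_\eta^\nu$ for $\lambda\le\eta\le\nu$, and $f_\lambda\circ g_\lambda^\eta=g_\lambda^\eta\circ f_\eta$ for $\lambda\le\eta$. Its inverse limit is the dynamical system on $\{\langle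 x_\lambda\rangle\in\prod X_\lambda: x_\lambda=g_\lambda^\eta(x_\eta)\ \forall\lambda\le\eta\}$ (subspace of the product) with the map $\langle x_\lambda\rangle\mapsto\langle f_\lambda(x_\lambda)\rangle$. Two systems $(f,X)$, $(g,Y)$ are conjugate if there is a homeomorphism $h:X\to Y$ with $h\circ f=g\circ h$. *)

theory Defs
  imports "HOL-Analysis.Analysis"
begin

text \<open>
  Spaces are abstract topologies, so a self-map of a space is a HOL function that only matters on
  \<^term>\<open>topspace X\<close>; equations between maps are required on that set only.
\<close>

definition dynamical_system :: "'a topology \<Rightarrow> ('a \<Rightarrow> 'a) \<Rightarrow> bool" where
  "dynamical_system X f \<longleftrightarrow> continuous_map X X f"

definition finite_open_cover :: "'a topology \<Rightarrow> 'a set set \<Rightarrow> bool" where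
  "finite_open_cover X \<U> \<longleftrightarrow> finite \<U> \<and> (\<forall>U\<in>\<U>. openin X U) \<and> \<Union>\<U> = topspace X"

definition pseudo_orbit ::
  "'a topology \<Rightarrow> ('a \<Rightarrow> 'a) \<Rightarrow> 'a set set \<Rightarrow> (nat \<Rightarrow> 'a) \<Rightarrow> bool" where
  "pseudo_orbit X f \<U> x \<longleftrightarrow>
     (\<forall>i. x i \<in> topspace X) \<and> (\<forall>i. \<exists>U\<in>\<U>. x (Suc i) \<in> U \<and> f (x i) \<in> U)"

definition cover_shadows ::
  "('a \<Rightarrow> 'a) \<Rightarrow> 'a set set \<Rightarrow> 'a \<Rightarrow> (nat \<Rightarrow> 'a) \<Rightarrow> bool" where
  "cover_shadows f \<U> z x \<longleftrightarrow> (\<forall>i. \<exists>U\<in>\<U>. x i \<in> U \<and> (f ^^ i) z \<in> U)"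

text \<open>Shadowing is a property of maps on nonempty spaces; nonemptiness is part of the definition.\<close>

definition has_shadowing :: "'a topology \<Rightarrow> ('a \<Rightarrow> 'a) \<Rightarrow> bool" where
  "has_shadowing X f \<longleftrightarrow> topspace X \<noteq> {} \<and>
     (\<forall>\<U>. finite_open_cover X \<U> \<longrightarrow>
        (\<exists>\<V>. finite_open_cover X \<V> \<and>
           (\<forall>x. pseudo_orbit X f \<V> x \<longrightarrow> (\<exists>z\<in>topspace X. cover_shadows f \<U> z x))))"

definition directed_set :: "'i set \<Rightarrow> ('i \<Rightarrow> 'i \<Rightarrow> bool) \<Rightarrow> bool" where
  "directed_set \<Lambda> le \<longleftrightarrow> \<Lambda> \<noteq> {} \<and>
     (\<forall>l\<in>\<Lambda>. le l l) \<and>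
     (\<forall>l\<in>\<Lambda>. \<forall>e\<in>\<Lambda>. \<forall>n\<in>\<Lambda>. le l e \<longrightarrow> le e n \<longrightarrow> le l n) \<and>
     (\<forall>l\<in>\<Lambda>. \<forall>e\<in>\<Lambda>. \<exists>n\<in>\<Lambda>. le l n \<and> le e n)"

text \<open>
  The bonding map from \<open>X e\<close> onto \<open>X l\<close>, for \<open>l\<close> below \<open>e\<close>, is \<open>g l e\<close>. All spaces \<open>X l\<close> live in
  one type \<open>'a\<close>, which is no restriction: a set-indexed family embeds in its disjoint union.
\<close>

definition inverse_system ::
  "'i set \<Rightarrow> ('i \<Rightarrow> 'i \<Rightarrow> bool) \<Rightarrow> ('i \<Rightarrow> 'a topology) \<Rightarrow> ('i \<Rightarrow> 'a \<Rightarrow> 'a) \<Rightarrow>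
   ('i \<Rightarrow> 'i \<Rightarrow> 'a \<Rightarrow> 'a) \<Rightarrow> bool" where
  "inverse_system \<Lambda> le X f g \<longleftrightarrow>
     directed_set \<Lambda> le \<and>
     (\<forall>l\<in>\<Lambda>. compact_space (X l) \<and> Hausdorff_space (X l) \<and> dynamical_system (X l) (f l)) \<and>
     (\<forall>l\<in>\<Lambda>. \<forall>e\<in>\<Lambda>. le l e \<longrightarrow>
        continuous_map (X e) (X l) (g l e) \<and> g l e ` topspace (X e) = topspace (X l)) \<and>
     (\<forall>l\<in>\<Lambda>. \<forall>x\<in>topspace (X l). g l l x = x) \<and>
     (\<forall>l\<in>\<Lambda>. \<forall>e\<in>\<Lambda>. \<forall>n\<in>\<Lambda>. le l e \<longrightarrow> le e n \<longrightarrow>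
        (\<forall>x\<in>topspace (X n). g l n x = g l e (g e n x))) \<and>
     (\<forall>l\<in>\<Lambda>. \<forall>e\<in>\<Lambda>. le l e \<longrightarrow> (\<forall>x\<in>topspace (X e). f l (g l e x) = g l e (f e x)))"

definition inverse_limit_space ::
  "'i set \<Rightarrow> ('i \<Rightarrow> 'i \<Rightarrow> bool) \<Rightarrow> ('i \<Rightarrow> 'a topology) \<Rightarrow> ('i \<Rightarrow> 'i \<Rightarrow> 'a \<Rightarrow> 'a) \<Rightarrow>
   ('i \<Rightarrow> 'a) topology" where
  "inverse_limit_space \<Lambda> le X g =
     subtopology (product_topology X \<Lambda>)
       {x. \<forall>l\<in>\<Lambda>. \<forall>e\<in>\<Lambda>. le l e \<longrightarrow> x l = g l e (x e)}"

text \<open>Points of \<^const>\<open>product_topology\<close> are extensional on the index set, hence the restriction.\<close>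

definition inverse_limit_map ::
  "'i set \<Rightarrow> ('i \<Rightarrow> 'a \<Rightarrow> 'a) \<Rightarrow> ('i \<Rightarrow> 'a) \<Rightarrow> ('i \<Rightarrow> 'a)" where
  "inverse_limit_map \<Lambda> f x = (\<lambda>l\<in>\<Lambda>. f l (x l))"

definition conjugate ::
  "'a topology \<Rightarrow> ('a \<Rightarrow> 'a) \<Rightarrow> 'b topology \<Rightarrow> ('b \<Rightarrow> 'b) \<Rightarrow> bool" where
  "conjugate X f Y g \<longleftrightarrow>
     (\<exists>h. homeomorphic_map X Y h \<and> (\<forall>x\<in>topspace X. h (f x) = g (h x)))"

end

theory Submission
  imports Defs
begin

text \<open>
  By compactness of the inverse limit and directedness of the index set, every finite open cover
  is refined by the pullback of a finite open cover of a single factor. Projections carry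
  pseudo-orbits to pseudo-orbits, and a shadowing point in the factor lifts to the limit because
  the projections are surjective; the lift shadows in the original cover. Conjugacy
  invariance of shadowing is an instance of the same argument.
\<close>

section \<open>Lifting shadowing from factors\<close>

text \<open>Two points whose \<open>q\<close>-images share a member of \<W> lie in the preimage of
  that member, hence by \<open>ref\<close> in one member of \<U>; so shadowing can be tested in the
  factor. The conclusion concerns a single \<U>, which leaves \<open>Y\<close> and \<open>q\<close>
  free to depend on the cover, as the inverse limit requires.\<close>

lemma has_shadowing_from_factor:
  assumes sh: "has_shadowing Y k"
    and q: "continuous_map X Y q" "q ` topspace X = topspace Y"
    and f: "\<And>x. x \<in> topspace X \<Longrightarrow> f x \<in> topspace X"
    and semi: "\<And>x. x \<in> topspace X \<Longrightarrow> q (f x) = k (q x)"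
    and W: "finite_open_cover Y \<W>"
    and ref: "\<And>W. W \<in> \<W> \<Longrightarrow> \<exists>U\<in>\<U>. {x \<in> topspace X. q x \<in> W} \<subseteq> U"
  shows "\<exists>\<V>. finite_open_cover X \<V> \<and>
           (\<forall>x. pseudo_orbit X f \<V> x \<longrightarrow> (\<exists>z\<in>topspace X. cover_shadows f \<U> z x))"
proof -
  obtain \<V> where V: "finite_open_cover Y \<V>"
    and Vs: "\<And>x. pseudo_orbit Y k \<V> x \<Longrightarrow> \<exists>z\<in>topspace Y. cover_shadows k \<W> z x"
    using sh W unfolding has_shadowing_def by blast
  \<comment> \<open>Pulling back \<V>, the cover that shadowing of \<open>k\<close> yields for \<W>,
    ensures that \<open>q\<close> maps pseudo-orbits for \<V>' to pseudo-orbits for \<V>.\<close>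
  define \<V>' where "\<V>' = (\<lambda>V. {x \<in> topspace X. q x \<in> V}) ` \<V>"
  have "finite_open_cover X \<V>'"
  proof -
    have fin: "finite \<V>" and opn: "\<And>V. V \<in> \<V> \<Longrightarrow> openin Y V" and cov: "\<Union>\<V> = topspace Y"
      using V by (auto simp: finite_open_cover_def)
    have "\<Union>\<V>' = {x \<in> topspace X. q x \<in> \<Union>\<V>}"
      by (auto simp: \<V>'_def)
    then have "\<Union>\<V>' = topspace X"
      using cov q(2) by auto
    then show ?thesis
      using fin opn openin_continuous_map_preimage[OF q(1)]
      by (auto simp: \<V>'_def finite_open_cover_def)
  qed
  moreover have "\<exists>z\<in>topspace X. cover_shadows f \<U> z x" if po: "pseudo_orbit X f \<V>' x" for x
  proof -
    have x: "x i \<in> topspace X" for i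
      using po by (simp add: pseudo_orbit_def)
    have "pseudo_orbit Y k \<V> (q \<circ> x)"
      unfolding pseudo_orbit_def
    proof (intro conjI allI)
      fix i
      show "(q \<circ> x) i \<in> topspace Y" using x q(2) by auto
      obtain V where "V \<in> \<V>" "q (x (Suc i)) \<in> V" "q (f (x i)) \<in> V"
        using po unfolding pseudo_orbit_def \<V>'_def by blast
      then show "\<exists>U\<in>\<V>. (q \<circ> x) (Suc i) \<in> U \<and> k ((q \<circ> x) i) \<in> U"
        using semi[OF x] by auto
    qed
    then obtain y where y: "y \<in> topspace Y" "cover_shadows k \<W> y (q \<circ> x)"
      using Vs by blast
    have "y \<in> q ` topspace X"
      using y(1) by (simp only: q(2))
    then obtain z where z: "z \<in> topspace X" "q z = y" by auto
    \<comment> \<open>Any preimage \<open>z\<close> of \<open>y\<close> will do: the semiconjugacy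
      sends its whole orbit to the orbit of \<open>y\<close>.\<close>
    have it: "(f ^^ i) z \<in> topspace X \<and> q ((f ^^ i) z) = (k ^^ i) y" for i
      by (induction i) (auto simp: z f semi)
    have "cover_shadows f \<U> z x"
      unfolding cover_shadows_def
    proof
      fix i
      obtain W where W: "W \<in> \<W>" "q (x i) \<in> W" "(k ^^ i) y \<in> W"
        using y(2) unfolding cover_shadows_def by auto
      with ref obtain U where U: "U \<in> \<U>" "{x \<in> topspace X. q x \<in> W} \<subseteq> U" by blast
      have "x i \<in> {x \<in> topspace X. q x \<in> W}" "(f ^^ i) z \<in> {x \<in> topspace X. q x \<in> W}"
        using W(2,3) x[of i] it[of i] by simp_all
      then show "\<exists>U\<in>\<U>. x i \<in> U \<and> (f ^^ i) z \<in> U"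
        using U by blast
    qed
    with z show ?thesis by blast
  qed
  ultimately show ?thesis by blast
qed

text \<open>The conjugacy \<open>h\<close> serves as the factor map, and the cover of
  \<open>Y\<close> consists of the images of the members of \<U>. These are open because
  \<open>h\<close> is an open map, and by injectivity the preimage of each image falls back into the
  member it came from.\<close>

lemma has_shadowing_conjugate:
  assumes "dynamical_system X f" "conjugate X f Y k" "has_shadowing Y k"
  shows "has_shadowing X f"
proof -
  obtain h where h: "homeomorphic_map X Y h" "\<And>x. x \<in> topspace X \<Longrightarrow> h (f x) = k (h x)"
    using assms(2) by (auto simp: conjugate_def)
  have cont: "continuous_map X Y h" and surj: "h ` topspace X = topspace Y"
    and inj: "inj_on h (topspace X)" and opn: "open_map X Y h"
    using h(1) by (simp_all add: homeomorphic_eq_everything_map)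
  show ?thesis
    unfolding has_shadowing_def
  proof (intro conjI allI impI)
    show "topspace X \<noteq> {}"
      using assms(3) surj by (metis has_shadowing_def image_empty)
    fix \<U> assume U: "finite_open_cover X \<U>"
    show "\<exists>\<V>. finite_open_cover X \<V> \<and>
           (\<forall>x. pseudo_orbit X f \<V> x \<longrightarrow> (\<exists>z\<in>topspace X. cover_shadows f \<U> z x))"
    proof (rule has_shadowing_from_factor[where f = f, OF assms(3) cont surj _ h(2)])
      show "f x \<in> topspace X" if "x \<in> topspace X" for x
        using assms(1) that by (auto simp: dynamical_system_def continuous_map_def)
      have "\<Union>((`) h ` \<U>) = topspace Y"
        using U surj by (metis finite_open_cover_def image_Union)
      then show "finite_open_cover Y ((`) h ` \<U>)"
        using U opn by (auto simp: finite_open_cover_def open_map_def)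
      show "\<exists>U\<in>\<U>. {x \<in> topspace X. h x \<in> W} \<subseteq> U" if W: "W \<in> (`) h ` \<U>" for W
      proof -
        obtain U0 where "U0 \<in> \<U>" "W = h ` U0" using W by blast
        moreover have "U0 \<subseteq> topspace X" using U \<open>U0 \<in> \<U>\<close> unfolding finite_open_cover_def by blast
        ultimately show ?thesis using inj by (auto simp: inj_on_def)
      qed
    qed auto
  qed
qed

section \<open>Inverse limits of compact Hausdorff systems\<close>

lemma directed_set_finite_bound:
  assumes "directed_set \<Lambda> le" "finite F" "F \<subseteq> \<Lambda>"
  shows "\<exists>n\<in>\<Lambda>. \<forall>l\<in>F. le l n"
  using assms(2,3)
proof (induction F)
  case empty
  then show ?case using assms(1) unfolding directed_set_def by blast
next
  case (insert a F)
  then obtain n where n: "n \<in> \<Lambda>" "\<forall>l\<in>F. le l n" by auto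
  obtain m where m: "m \<in> \<Lambda>" "le n m" "le a m"
    using assms(1) insert.prems n(1) unfolding directed_set_def by blast
  have "le l m" if "l \<in> F" for l
    using assms(1) insert.prems n m that unfolding directed_set_def by blast
  with m show ?case by auto
qed

lemma topspace_inverse_limit_space:
  "topspace (inverse_limit_space \<Lambda> le X g) =
     {x \<in> \<Pi>\<^sub>E l\<in>\<Lambda>. topspace (X l). \<forall>l\<in>\<Lambda>. \<forall>e\<in>\<Lambda>. le l e \<longrightarrow> x l = g l e (x e)}"
  by (auto simp: inverse_limit_space_def)

context
  fixes \<Lambda> :: "'i set" and le :: "'i \<Rightarrow> 'i \<Rightarrow> bool"
    and X :: "'i \<Rightarrow> 'a topology" and f :: "'i \<Rightarrow> 'a \<Rightarrow> 'a"
    and g :: "'i \<Rightarrow> 'i \<Rightarrow> 'a \<Rightarrow> 'a"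
  assumes sys: "inverse_system \<Lambda> le X f g"
begin

private abbreviation (input) L where "L \<equiv> inverse_limit_space \<Lambda> le X g"

lemma inverse_system_directed: "directed_set \<Lambda> le"
  using sys by (simp add: inverse_system_def)

lemma inverse_system_trans:
  "le l e \<Longrightarrow> le e n \<Longrightarrow> l \<in> \<Lambda> \<Longrightarrow> e \<in> \<Lambda> \<Longrightarrow> n \<in> \<Lambda> \<Longrightarrow> le l n"
  using inverse_system_directed unfolding directed_set_def by blast

lemma inverse_system_bound:
  assumes "l \<in> \<Lambda>" "e \<in> \<Lambda>"
  obtains n where "n \<in> \<Lambda>" "le l n" "le e n"
  using inverse_system_directed assms unfolding directed_set_def by blast

lemma inverse_system_spaces:
  assumes "l \<in> \<Lambda>"
  shows "compact_space (X l)" "Hausdorff_space (X l)" "continuous_map (X l) (X l) (f l)"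
  using sys assms unfolding inverse_system_def dynamical_system_def by blast+

lemma inverse_system_bonding:
  assumes "l \<in> \<Lambda>" "e \<in> \<Lambda>" "le l e"
  shows "continuous_map (X e) (X l) (g l e)" "g l e ` topspace (X e) = topspace (X l)"
  using sys assms unfolding inverse_system_def by blast+

lemma inverse_system_bonding_comp:
  assumes "l \<in> \<Lambda>" "e \<in> \<Lambda>" "n \<in> \<Lambda>" "le l e" "le e n" "x \<in> topspace (X n)"
  shows "g l n x = g l e (g e n x)"
  using sys assms unfolding inverse_system_def by blast

lemma inverse_system_equivariant:
  assumes "l \<in> \<Lambda>" "e \<in> \<Lambda>" "le l e" "x \<in> topspace (X e)"
  shows "f l (g l e x) = g l e (f e x)"
  using sys assms unfolding inverse_system_def by blast

section \<open>Compactness of the inverse limit\<close>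

lemma compact_space_product_inverse_system: "compact_space (product_topology X \<Lambda>)"
  by (simp add: compact_space_product_topology inverse_system_spaces)

text \<open>Two continuous maps into the Hausdorff space \<open>X l\<close> agree on a closed set;
  here they are the projection to \<open>l\<close> and the projection to \<open>e\<close> followed
  by the bonding map.\<close>

lemma closedin_bonding_equation:
  assumes "l \<in> \<Lambda>" "e \<in> \<Lambda>" "le l e"
  shows "closedin (product_topology X \<Lambda>) {x \<in> topspace (product_topology X \<Lambda>). x l = g l e (x e)}"
proof (rule closedin_continuous_maps_eq[OF inverse_system_spaces(2)[OF assms(1)]])
  show "continuous_map (product_topology X \<Lambda>) (X l) (\<lambda>x. g l e (x e))"
    using continuous_map_compose[OF continuous_map_product_projection[OF assms(2), of X]
        inverse_system_bonding(1)[OF assms]]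
    by (simp add: o_def)
qed (use assms in \<open>simp add: continuous_map_product_projection\<close>)

text \<open>The product is compact by Tychonoff, and the limit is cut out of it by closed bonding
  equations.\<close>

lemma compact_space_inverse_limit: "compact_space L"
proof -
  let ?P = "product_topology X \<Lambda>"
  \<comment> \<open>Inserting the whole space makes the family visibly nonempty, as
    \<open>closedin_Inter\<close> demands, and keeps the intersection inside the product.\<close>
  let ?C = "insert (topspace ?P)
    {{x \<in> topspace ?P. x l = g l e (x e)} | l e. l \<in> \<Lambda> \<and> e \<in> \<Lambda> \<and> le l e}"
  have "closedin ?P (\<Inter>?C)"
    by (rule closedin_Inter) (auto intro!: closedin_bonding_equation simp del: topspace_product_topology)
  then have "compactin ?P (\<Inter>?C)"
    by (rule closedin_compact_space[OF compact_space_product_inverse_system])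
  moreover have "\<Inter>?C = topspace L"
    unfolding topspace_inverse_limit_space topspace_product_topology by blast
  \<comment> \<open>The set defining the limit also contains functions outside the product, so it is
    replaced by its trace, which is the set just shown compact.\<close>
  moreover have "L = subtopology ?P (topspace L)"
    unfolding inverse_limit_space_def by (metis subtopology_restrict topspace_subtopology)
  ultimately show ?thesis
    by (metis compact_space_subtopology)
qed

section \<open>Projections of the limit onto its factors\<close>

lemma inverse_limit_projection:
  assumes "l \<in> \<Lambda>"
  shows "continuous_map L (X l) (\<lambda>x. x l)"
  unfolding inverse_limit_space_def
  by (intro continuous_map_from_subtopology continuous_map_product_projection assms)

text \<open>
  The closed sets \<open>C n\<close> of points compatible below \<open>n\<close> and lying over \<open>z\<close> are nonempty and
  decrease along the directed order, so compactness gives a point in all of them.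
\<close>

lemma inverse_limit_projection_surj:
  assumes l0: "l0 \<in> \<Lambda>"
  shows "(\<lambda>x. x l0) ` topspace L = topspace (X l0)"
proof
  show "(\<lambda>x. x l0) ` topspace L \<subseteq> topspace (X l0)"
    using continuous_map_image_subset_topspace[OF inverse_limit_projection[OF l0]] .
  show "topspace (X l0) \<subseteq> (\<lambda>x. x l0) ` topspace L"
  proof
    fix z assume z: "z \<in> topspace (X l0)"
    let ?P = "product_topology X \<Lambda>"
    \<comment> \<open>A factor above both \<open>l\<close> and \<open>l0\<close> maps onto both, so
      nonemptiness passes from \<open>X l0\<close> to \<open>X l\<close>. This justifies the
      arbitrary choice of coordinates below.\<close>
    have ne: "topspace (X l) \<noteq> {}" if l: "l \<in> \<Lambda>" for l
    proof -
      obtain m where m: "m \<in> \<Lambda>" "le l m" "le l0 m"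
        using inverse_system_bound[OF l l0] by metis
      then have "topspace (X m) \<noteq> {}"
        using inverse_system_bonding(2)[OF l0 m(1,3)] z by auto
      then show ?thesis
        using inverse_system_bonding(2)[OF l m(1,2)] by (metis image_is_empty)
    qed
    define C where "C n = {x \<in> topspace ?P. x l0 = z \<and>
        (\<forall>l\<in>\<Lambda>. le l n \<longrightarrow> x l = g l n (x n))}" for n
    \<comment> \<open>For \<open>x\<close> in \<open>C n\<close> the coordinates at \<open>e\<close>
      and at everything below \<open>e\<close> are images of \<open>x n\<close>, so composing
      bonding maps gives compatibility below \<open>e\<close>.\<close>
    have anti: "C n \<subseteq> C e" if en: "e \<in> \<Lambda>" "n \<in> \<Lambda>" "le e n" for e n
    proof
      fix x assume x: "x \<in> C n"
      then have "x n \<in> topspace (X n)" using en by (auto simp: C_def)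
      have "x l = g l e (x e)" if l: "l \<in> \<Lambda>" "le l e" for l
      proof -
        have "le l n" using inverse_system_trans l en by blast
        then have "x l = g l n (x n)" "x e = g e n (x n)"
          using x l en by (auto simp: C_def)
        then show ?thesis
          using inverse_system_bonding_comp[of l e n "x n"] l en \<open>x n \<in> topspace (X n)\<close> by simp
      qed
      then show "x \<in> C e" using x by (auto simp: C_def)
    qed
    have nonempty: "C n \<noteq> {}" if n: "n \<in> \<Lambda>" "le l0 n" for n
    proof -
      obtain y where y: "y \<in> topspace (X n)" "g l0 n y = z"
        using inverse_system_bonding(2)[OF l0 n] z by (metis imageE)
      \<comment> \<open>Coordinates below \<open>n\<close> are dictated by the lift \<open>y\<close>
        of \<open>z\<close>; the others are arbitrary points, which the conditions in
        \<open>C n\<close> do not see.\<close>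
      define x where
        "x = (\<lambda>l\<in>\<Lambda>. if le l n then g l n y else SOME a. a \<in> topspace (X l))"
      have "x l \<in> topspace (X l)" if l: "l \<in> \<Lambda>" for l
      proof (cases "le l n")
        case True
        then have "g l n y \<in> topspace (X l)"
          using inverse_system_bonding(2)[OF l n(1)] y(1) by blast
        then show ?thesis using True l by (simp add: x_def)
      next
        case False
        then show ?thesis using ne[OF l] l by (simp add: x_def some_in_eq)
      qed
      moreover have "le n n"
        using inverse_system_directed n(1) unfolding directed_set_def by blast
      moreover have "g n n y = y"
        using sys n(1) y(1) unfolding inverse_system_def by blast
      ultimately have "x \<in> C n"
        using n y l0 by (auto simp: C_def x_def)
      then show ?thesis by blast
    qed
    have closed: "closedin ?P (C n)" if n: "n \<in> \<Lambda>" for n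
    proof -
      \<comment> \<open>The fibre over the closed point \<open>z\<close>, together with one bonding
        equation for each \<open>l\<close> below \<open>n\<close>.\<close>
      let ?D = "insert {x \<in> topspace ?P. x l0 \<in> {z}}
        {{x \<in> topspace ?P. x l = g l n (x n)} | l. l \<in> \<Lambda> \<and> le l n}"
      have "closedin (X l0) {z}"
        by (rule closedin_Hausdorff_singleton[OF inverse_system_spaces(2)[OF l0] z])
      then have "closedin ?P {x \<in> topspace ?P. x l0 \<in> {z}}"
        by (rule closedin_continuous_map_preimage[OF continuous_map_product_projection[OF l0, of X]])
      then have "closedin ?P (\<Inter>?D)"
        using n
        by (intro closedin_Inter)
          (auto intro!: closedin_bonding_equation simp del: topspace_product_topology)
      moreover have "\<Inter>?D = C n"
        unfolding C_def by blast
      ultimately show ?thesis by simp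
    qed
    let ?\<C> = "C ` {n \<in> \<Lambda>. le l0 n}"
    have "\<Inter>\<F> \<noteq> {}" if F: "finite \<F>" "\<F> \<subseteq> ?\<C>" for \<F>
    proof -
      obtain N where N: "finite N" "N \<subseteq> {n \<in> \<Lambda>. le l0 n}" "\<F> = C ` N"
        using finite_subset_image[OF F] by blast
      \<comment> \<open>Including \<open>l0\<close> places the common bound \<open>m\<close> above
        it, so that \<open>C m\<close> is nonempty as well as contained in every member of the
        subfamily.\<close>
      have "finite (insert l0 N)" "insert l0 N \<subseteq> \<Lambda>"
        using N(1,2) l0 by auto
      then obtain m where m: "m \<in> \<Lambda>" "\<forall>l\<in>insert l0 N. le l m"
        using directed_set_finite_bound[OF inverse_system_directed] by blast
      have "C m \<subseteq> C n" if "n \<in> N" for n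
        using anti N(2) m that by blast
      then have "C m \<subseteq> \<Inter>\<F>"
        unfolding N(3) by blast
      then show ?thesis using nonempty m by blast
    qed
    moreover have "\<forall>K\<in>?\<C>. closedin ?P K"
      using closed by blast
    ultimately have "\<Inter>?\<C> \<noteq> {}"
      using compact_space_product_inverse_system[unfolded compact_space_fip, rule_format, of ?\<C>]
      by blast
    then obtain x where x: "\<And>n. n \<in> \<Lambda> \<Longrightarrow> le l0 n \<Longrightarrow> x \<in> C n" by blast
    have "x l = g l e (x e)" if le: "l \<in> \<Lambda>" "e \<in> \<Lambda>" "le l e" for l e
    proof -
      \<comment> \<open>The index \<open>e\<close> need not lie above \<open>l0\<close>; membership
        in \<open>C e\<close> descends from a common upper bound.\<close>
      obtain n where "n \<in> \<Lambda>" "le e n" "le l0 n"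
        using inverse_system_bound[OF le(2) l0] by metis
      then have "x \<in> C e" using x anti le by blast
      then show ?thesis using le unfolding C_def by blast
    qed
    moreover obtain n where "n \<in> \<Lambda>" "le l0 n"
      using inverse_system_bound[OF l0 l0] by metis
    then have "x \<in> topspace ?P" "x l0 = z" using x unfolding C_def by blast+
    ultimately have "x \<in> topspace L"
      unfolding topspace_inverse_limit_space topspace_product_topology by blast
    with \<open>x l0 = z\<close> show "z \<in> (\<lambda>x. x l0) ` topspace L" by blast
  qed
qed

section \<open>Refining covers of the limit by covers of one factor\<close>

text \<open>A basic box of the product restricts finitely many coordinates. On the limit, all of
  these are functions of the coordinate at any common upper bound \<open>n\<close>, so a condition
  on that coordinate alone expresses them.\<close>

lemma inverse_limit_basic_neighbourhood:
  assumes U: "openin L U" and x: "x \<in> U"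
  shows "\<exists>n\<in>\<Lambda>. \<exists>W. openin (X n) W \<and> x n \<in> W \<and> {y \<in> topspace L. y n \<in> W} \<subseteq> U"
proof -
  obtain T where T: "openin (product_topology X \<Lambda>) T"
    "U = T \<inter> {x. \<forall>l\<in>\<Lambda>. \<forall>e\<in>\<Lambda>. le l e \<longrightarrow> x l = g l e (x e)}"
    using U by (auto simp: inverse_limit_space_def openin_subtopology)
  then have xT: "x \<in> T" using x by blast
  obtain V where V: "finite {i \<in> \<Lambda>. V i \<noteq> topspace (X i)}" "\<forall>i\<in>\<Lambda>. openin (X i) (V i)"
    "x \<in> Pi\<^sub>E \<Lambda> V" "Pi\<^sub>E \<Lambda> V \<subseteq> T"
    using T(1) xT unfolding openin_product_topology_alt by blast
  define F where "F = {i \<in> \<Lambda>. V i \<noteq> topspace (X i)}"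
  have F: "finite F" "F \<subseteq> \<Lambda>" using V(1) by (auto simp: F_def)
  obtain n where n: "n \<in> \<Lambda>" "\<forall>l\<in>F. le l n"
    using directed_set_finite_bound[OF inverse_system_directed F] by blast
  have xL: "x \<in> topspace L" using U x openin_subset by blast
  have compat: "y l = g l n (y n)" if "y \<in> topspace L" "l \<in> F" for y l
    using that F(2) n by (auto simp: topspace_inverse_limit_space)
  \<comment> \<open>The restrictions are pulled back to \<open>X n\<close>. The factor
    \<open>topspace (X n)\<close> keeps \<open>W\<close> inside the space when \<open>F\<close> is
    empty and the indexed intersection is everything, a case the openness proof treats
    separately.\<close>
  define W where "W = topspace (X n) \<inter> (\<Inter>l\<in>F. {a \<in> topspace (X n). g l n a \<in> V l})"
  have "openin (X n) W"
  proof (cases "F = {}")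
    case False
    have "openin (X n) {a \<in> topspace (X n). g l n a \<in> V l}" if "l \<in> F" for l
      using that F(2) n V(2)
      by (intro openin_continuous_map_preimage[OF inverse_system_bonding(1)]) auto
    then show ?thesis
      unfolding W_def using F(1) False by (intro openin_Int openin_INT2) auto
  qed (simp add: W_def)
  moreover have "x n \<in> W"
  proof -
    have "g l n (x n) \<in> V l" if "l \<in> F" for l
      using compat[OF xL that] V(3) that F(2) by (metis PiE_mem subsetD)
    moreover have "x n \<in> topspace (X n)"
      using xL n(1) by (auto simp: topspace_inverse_limit_space)
    ultimately show ?thesis by (simp add: W_def)
  qed
  moreover have "{y \<in> topspace L. y n \<in> W} \<subseteq> U"
  proof clarify
    fix y assume y: "y \<in> topspace L" "y n \<in> W"
    have "y i \<in> V i" if "i \<in> \<Lambda>" for i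
    proof (cases "i \<in> F")
      case True
      then show ?thesis using compat[OF y(1) True] y(2) by (auto simp: W_def)
    next
      case False
      then show ?thesis using y(1) that by (auto simp: F_def topspace_inverse_limit_space)
    qed
    then have "y \<in> Pi\<^sub>E \<Lambda> V"
      using y(1) by (auto simp: topspace_inverse_limit_space PiE_iff)
    then show "y \<in> U"
      using T(2) V(4) y(1) unfolding topspace_inverse_limit_space by blast
  qed
  ultimately show ?thesis using n(1) by blast
qed

text \<open>Compactness leaves finitely many one-coordinate open sets, each inside a member of \<U>,
  and directedness moves all of them to one coordinate.\<close>

lemma inverse_limit_cover_refinement:
  assumes U: "finite_open_cover L \<U>"
  shows "\<exists>n\<in>\<Lambda>. \<exists>\<W>. finite_open_cover (X n) \<W> \<and>
           (\<forall>W\<in>\<W>. \<exists>U\<in>\<U>. {x \<in> topspace L. x n \<in> W} \<subseteq> U)"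
proof -
  \<comment> \<open>A pair of an index and a subset of that factor encodes a cylinder. Working with
    pairs remembers the index, which the cylinder as a set does not determine.\<close>
  define B where "B p = {x \<in> topspace L. x (fst p) \<in> snd p}" for p :: "'i \<times> 'a set"
  define I where "I = {p. fst p \<in> \<Lambda> \<and> openin (X (fst p)) (snd p) \<and> (\<exists>U\<in>\<U>. B p \<subseteq> U)}"
  have B_open: "openin L (B p)" if "p \<in> I" for p
    unfolding B_def using that
    by (intro openin_continuous_map_preimage[OF inverse_limit_projection]) (auto simp: I_def)
  have cov: "\<exists>p\<in>I. x \<in> B p" if x: "x \<in> topspace L" for x
  proof -
    obtain U where "U \<in> \<U>" "x \<in> U" "openin L U"
      using U x unfolding finite_open_cover_def by blast
    with inverse_limit_basic_neighbourhood[of U x] obtain n W where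
      "n \<in> \<Lambda>" "openin (X n) W" "x n \<in> W" "{y \<in> topspace L. y n \<in> W} \<subseteq> U" by blast
    with \<open>U \<in> \<U>\<close> x show ?thesis
      by (intro bexI[of _ "(n, W)"]) (auto simp: I_def B_def)
  qed
  have "compactin L (topspace L)"
    using compact_space_inverse_limit by (simp add: compact_space_def)
  moreover have "\<And>V. V \<in> B ` I \<Longrightarrow> openin L V" "topspace L \<subseteq> \<Union>(B ` I)"
    using B_open cov by blast+
  ultimately have "\<exists>\<F>. finite \<F> \<and> \<F> \<subseteq> B ` I \<and> topspace L \<subseteq> \<Union>\<F>"
    by (rule compactinD)
  then obtain \<F> where \<F>: "finite \<F>" "\<F> \<subseteq> B ` I" "topspace L \<subseteq> \<Union>\<F>" by blast
  obtain J where "J \<subseteq> I" "finite J" "\<F> = B ` J"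
    using finite_subset_image[OF \<F>(1,2)] by blast
  with \<F>(3) have J: "finite J" "J \<subseteq> I" "topspace L \<subseteq> \<Union>(B ` J)" by simp_all
  have "finite (fst ` J)" "fst ` J \<subseteq> \<Lambda>"
    using J by (auto simp: I_def)
  then obtain N where N: "N \<in> \<Lambda>" "\<forall>l\<in>fst ` J. le l N"
    using directed_set_finite_bound[OF inverse_system_directed] by blast
  have JN: "fst p \<in> \<Lambda>" "le (fst p) N" "openin (X (fst p)) (snd p)" if "p \<in> J" for p
    using that J(2) N(2) by (auto simp: I_def)
  \<comment> \<open>The base of the cylinder is pulled back along the bonding map from
    \<open>N\<close>, so that on the limit \<open>R p\<close>, read at coordinate \<open>N\<close>,
    describes exactly \<open>B p\<close>.\<close>
  define R where "R p = {a \<in> topspace (X N). g (fst p) N a \<in> snd p}" for p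
  have R: "x N \<in> R p \<longleftrightarrow> x \<in> B p" if p: "p \<in> J" and x: "x \<in> topspace L" for p x
  proof -
    have "x (fst p) = g (fst p) N (x N)" "x N \<in> topspace (X N)"
      using JN[OF p] N(1) x unfolding topspace_inverse_limit_space by blast+
    then show ?thesis using x by (simp add: R_def B_def)
  qed
  have "finite_open_cover (X N) (R ` J)"
    unfolding finite_open_cover_def
  proof (intro conjI ballI)
    show "openin (X N) V" if V: "V \<in> R ` J" for V
    proof -
      obtain p where p: "p \<in> J" "V = R p" using V by blast
      show ?thesis
        unfolding p(2) R_def
        by (rule openin_continuous_map_preimage
            [OF inverse_system_bonding(1)[OF JN(1)[OF p(1)] N(1) JN(2)[OF p(1)]] JN(3)[OF p(1)]])
    qed
    \<comment> \<open>Surjectivity of the projection is essential: the cylinders only control points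
      of \<open>X N\<close> that are coordinates of limit points.\<close>
    have "a \<in> \<Union>(R ` J)" if a: "a \<in> topspace (X N)" for a
    proof -
      have "a \<in> (\<lambda>x. x N) ` topspace L"
        using a by (simp only: inverse_limit_projection_surj[OF N(1)])
      then obtain x where x: "x \<in> topspace L" "x N = a" by auto
      then obtain p where p: "p \<in> J" "x \<in> B p" using J(3) by blast
      then have "a \<in> R p" using R[OF p(1) x(1)] x(2) by simp
      with p(1) show ?thesis by (rule UN_I)
    qed
    moreover have "\<Union>(R ` J) \<subseteq> topspace (X N)"
      by (auto simp: R_def)
    ultimately show "\<Union>(R ` J) = topspace (X N)" by blast
  qed (use J in simp)
  moreover have "\<exists>U\<in>\<U>. {x \<in> topspace L. x N \<in> W} \<subseteq> U" if W: "W \<in> R ` J" for W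
  proof -
    obtain p where p: "p \<in> J" "W = R p" using W by blast
    have "{x \<in> topspace L. x N \<in> W} \<subseteq> B p"
      unfolding p(2) using R[OF p(1)] by auto
    moreover have "\<exists>U\<in>\<U>. B p \<subseteq> U" using p J(2) by (auto simp: I_def)
    ultimately show ?thesis by blast
  qed
  ultimately show ?thesis using N(1) by blast
qed

section \<open>The induced map and its shadowing\<close>

text \<open>Compatibility of coordinates survives because the bonding maps intertwine the maps
  \<open>f l\<close>.\<close>

lemma inverse_limit_map_closed:
  assumes x: "x \<in> topspace L"
  shows "inverse_limit_map \<Lambda> f x \<in> topspace L"
proof -
  have xl: "x l \<in> topspace (X l)" if "l \<in> \<Lambda>" for l
    using x that by (auto simp: topspace_inverse_limit_space)
  have "f l (x l) \<in> topspace (X l)" if "l \<in> \<Lambda>" for l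
    using continuous_map_image_subset_topspace[OF inverse_system_spaces(3)[OF that]] xl[OF that] by blast
  moreover have "f l (x l) = g l e (f e (x e))" if "l \<in> \<Lambda>" "e \<in> \<Lambda>" "le l e" for l e
    using inverse_system_equivariant[OF that xl[OF that(2)]] x that
    by (simp add: topspace_inverse_limit_space)
  ultimately show ?thesis
    by (auto simp: topspace_inverse_limit_space inverse_limit_map_def)
qed

lemma has_shadowing_inverse_limit:
  assumes sh: "\<And>l. l \<in> \<Lambda> \<Longrightarrow> has_shadowing (X l) (f l)"
  shows "has_shadowing L (inverse_limit_map \<Lambda> f)"
  unfolding has_shadowing_def
proof (intro conjI allI impI)
  obtain l where l: "l \<in> \<Lambda>"
    using inverse_system_directed unfolding directed_set_def by blast
  \<comment> \<open>Nonemptiness is part of shadowing in the factor and lifts through the surjective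
    projection.\<close>
  have "(\<lambda>x. x l) ` topspace L \<noteq> {}"
    unfolding inverse_limit_projection_surj[OF l]
    by (rule conjunct1[OF sh[OF l, unfolded has_shadowing_def]])
  then show "topspace L \<noteq> {}" by blast
  fix \<U> assume \<U>: "finite_open_cover L \<U>"
  \<comment> \<open>The index \<open>n\<close> depends on \<U>: each cover of the limit is handled
    by shadowing in its own factor.\<close>
  obtain n \<W> where n: "n \<in> \<Lambda>" and W: "finite_open_cover (X n) \<W>"
    and ref: "\<forall>W\<in>\<W>. \<exists>U\<in>\<U>. {x \<in> topspace L. x n \<in> W} \<subseteq> U"
    using inverse_limit_cover_refinement[OF \<U>] by (elim bexE exE conjE)
  show "\<exists>\<V>. finite_open_cover L \<V> \<and>
      (\<forall>x. pseudo_orbit L (inverse_limit_map \<Lambda> f) \<V> x \<longrightarrow>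
        (\<exists>z\<in>topspace L. cover_shadows (inverse_limit_map \<Lambda> f) \<U> z x))"
  proof (rule has_shadowing_from_factor[where f = "inverse_limit_map \<Lambda> f" and k = "f n" and q = "\<lambda>x. x n",
        OF sh[OF n] inverse_limit_projection[OF n] inverse_limit_projection_surj[OF n] _ _ W])
    show "inverse_limit_map \<Lambda> f x \<in> topspace L" if "x \<in> topspace L" for x
      using that by (rule inverse_limit_map_closed)
    show "inverse_limit_map \<Lambda> f x n = f n (x n)" for x
      by (simp add: inverse_limit_map_def n)
    show "\<exists>U\<in>\<U>. {x \<in> topspace L. x n \<in> W} \<subseteq> U" if "W \<in> \<W>" for W
      using ref that by (rule bspec)
  qed
qed

end

theorem theorem7:
  fixes X :: "'b topology" and f :: "'b \<Rightarrow> 'b"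
    and \<Lambda> :: "'i set" and le :: "'i \<Rightarrow> 'i \<Rightarrow> bool"
    and Xs :: "'i \<Rightarrow> 'a topology" and fs :: "'i \<Rightarrow> 'a \<Rightarrow> 'a"
    and g :: "'i \<Rightarrow> 'i \<Rightarrow> 'a \<Rightarrow> 'a"
  assumes "dynamical_system X f"
    and "inverse_system \<Lambda> le Xs fs g"
    and "\<And>l. l \<in> \<Lambda> \<Longrightarrow> has_shadowing (Xs l) (fs l)"
    and "conjugate X f (inverse_limit_space \<Lambda> le Xs g) (inverse_limit_map \<Lambda> fs)"
  shows "has_shadowing X f"
proof (rule has_shadowing_conjugate[OF assms(1,4)])
  show "has_shadowing (inverse_limit_space \<Lambda> le Xs g) (inverse_limit_map \<Lambda> fs)"
    by (rule has_shadowing_inverse_limit[OF assms(2)]) (rule assms(3))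
qed

end
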